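(* Let $\mathbf{E}$ be a Euclidean space with closed unit ball $B$, let $F, C \subset \mathbf{E}$ be closed sets, and let $\bar x \in F \cap C$. Suppose $C$ is super-regular at $\bar x$. Suppose furthermore that $F$ and $C$ have strongly regular intersection at $\bar x$, that is, $N_F(\bar x) \cap -N_C(\bar x) = \{0\}$, or equivalently, the constant $$\bar c = \max\{ \langle u, v\rangle : u \in N_F(\bar x) \cap B,\ v \in -N_C(\bar x) \cap B \}$$ is strictly less than one. Fix any constant $c \in (\bar c, 1)$. Then, for any initial point $x_0 \in C$ sufficiently close to $\bar x$, any sequence of iterated projections $$x_{2n+1} \in P_F(x_{2n}), \qquad x_{2n+2} \in P_C(x_{2n+1}) \qquad (n = 0,1,2,\ldots)$$ must converge to a point in $F \cap C$ with R-linear rate $\sqrt{c}$.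
   Context: For a set $F \subset \mathbf{E}$, $P_F(x) = \operatorname{argmin}\{\|z-x\| : z \in F\}$ is the (multivalued) projection. For a closed set $F$ and $\bar x \in F$, the normal cone is $N_F(\bar x) = \{ \lim_i t_i(x_i - z_i) : t_i \ge 0,\ x_i \to \bar x,\ z_i \in P_F(x_i)\}$. A closed set $C$ is super-regular at $\bar x \in C$ if for every $\delta > 0$ there is a neighborhood of $\bar x$ such that for all points $u, z$ in that neighborhood with $z \in C$ and all $y \in P_C(u)$, $\langle z-y, u-y\rangle \le \delta \|z-y\|\cdot\|u-y\|$. A sequence $(x_k)$ converges to $\hat x$ with R-linear rate $r \in (0,1)$ if there is a constant $K$ with $\|x_k - \hat x\| \le K r^k$ for all $k$. *)

theory Defs
  imports "HOL-Analysis.Analysis"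
begin

definition proj_set :: "'a::euclidean_space set \<Rightarrow> 'a \<Rightarrow> 'a set" where
  "proj_set F x = {z. is_arg_min (\<lambda>z. norm (z - x)) (\<lambda>z. z \<in> F) z}"

(* Limiting normals, built from proximal normals; meant for closed F and xbar in F. *)
definition normal_cone :: "'a::euclidean_space set \<Rightarrow> 'a \<Rightarrow> 'a set" where
  "normal_cone F xbar =
     {v. \<exists>(t :: nat \<Rightarrow> real) (x :: nat \<Rightarrow> 'a) (z :: nat \<Rightarrow> 'a).
           (\<forall>i. t i \<ge> 0) \<and> x \<longlonglongrightarrow> xbar \<and> (\<forall>i. z i \<in> proj_set F (x i)) \<and>
           (\<lambda>i. t i *\<^sub>R (x i - z i)) \<longlonglongrightarrow> v}"

definition super_regular_at :: "'a::euclidean_space set \<Rightarrow> 'a \<Rightarrow> bool" where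
  "super_regular_at C xbar \<longleftrightarrow>
     (\<forall>\<delta>>0. \<exists>U. open U \<and> xbar \<in> U \<and>
        (\<forall>u\<in>U. \<forall>z\<in>U \<inter> C. \<forall>y\<in>proj_set C u.
           (z - y) \<bullet> (u - y) \<le> \<delta> * norm (z - y) * norm (u - y)))"

definition strongly_regular_intersection ::
    "'a::euclidean_space set \<Rightarrow> 'a set \<Rightarrow> 'a \<Rightarrow> bool" where
  "strongly_regular_intersection F C xbar \<longleftrightarrow>
     normal_cone F xbar \<inter> uminus ` normal_cone C xbar = {0}"

definition normal_products ::
    "'a::euclidean_space set \<Rightarrow> 'a set \<Rightarrow> 'a \<Rightarrow> real set" where
  "normal_products F C xbar =
     {u \<bullet> v | u v. u \<in> normal_cone F xbar \<inter> cball 0 1 \<and>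
                    v \<in> uminus ` normal_cone C xbar \<inter> cball 0 1}"

(* The maximum is written as a supremum, since Max is only meaningful on finite sets. *)
definition regularity_const ::
    "'a::euclidean_space set \<Rightarrow> 'a set \<Rightarrow> 'a \<Rightarrow> real" where
  "regularity_const F C xbar = Sup (normal_products F C xbar)"

definition R_linear_convergence ::
    "(nat \<Rightarrow> 'a::euclidean_space) \<Rightarrow> 'a \<Rightarrow> real \<Rightarrow> bool" where
  "R_linear_convergence x xhat r \<longleftrightarrow>
     0 < r \<and> r < 1 \<and> (\<exists>K. \<forall>k. norm (x k - xhat) \<le> K * r ^ k)"

definition iterated_projections ::
    "'a::euclidean_space set \<Rightarrow> 'a set \<Rightarrow> (nat \<Rightarrow> 'a) \<Rightarrow> bool" where
  "iterated_projections F C x \<longleftrightarrow>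
     (\<forall>n. x (2 * n + 1) \<in> proj_set F (x (2 * n)) \<and>
          x (2 * n + 2) \<in> proj_set C (x (2 * n + 1)))"

end

theory Submission
  imports Defs
begin

text \<open>
  Let \<open>z \<in> C\<close>, \<open>y \<in> P\<^sub>F(z)\<close> and \<open>u \<in> P\<^sub>C(y)\<close>, all near the base point.
  Then \<open>\<parallel>u - y\<parallel>\<^sup>2 = \<langle>z - y, u - y\<rangle> + \<langle>z - u, y - u\<rangle>\<close>. The first term is at most
  \<open>c' \<parallel>z - y\<parallel> \<parallel>u - y\<parallel>\<close> for any \<open>c'\<close> above the regularity constant, by compactness of the unit
  sphere; the second is at most \<open>\<delta> \<parallel>z - u\<parallel> \<parallel>y - u\<parallel> \<le> 2 \<delta> \<parallel>z - y\<parallel> \<parallel>y - u\<parallel>\<close> by super-regularity.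
  Hence \<open>\<parallel>u - y\<parallel> \<le> (c' + 2 \<delta>) \<parallel>z - y\<parallel>\<close>: every projection onto \<open>C\<close> shortens the step by a
  factor \<open>c\<close>, while a projection onto \<open>F\<close> does not lengthen it. The iterates therefore stay near
  the base point and form a Cauchy sequence.
\<close>

section \<open>Projections and normal cones\<close>

lemma mem_proj_set_iff:
  "z \<in> proj_set F x \<longleftrightarrow> z \<in> F \<and> (\<forall>w\<in>F. dist x z \<le> dist x w)"
  by (auto simp: proj_set_def is_arg_min_linorder dist_norm norm_minus_commute)

text \<open>Trades the sequences for a single approximation at each accuracy \<open>e\<close>.
  Choosing witnesses for e = 1/(i+1) recovers the sequences, and closedness of the cone becomes a
  triangle inequality instead of a diagonal argument.\<close>

lemma mem_normal_cone_iff: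
  "v \<in> normal_cone F a \<longleftrightarrow>
    (\<forall>e>0. \<exists>t x z. 0 \<le> t \<and> dist x a < e \<and> z \<in> proj_set F x \<and> dist (t *\<^sub>R (x - z)) v < e)"
  (is "_ \<longleftrightarrow> ?R")
proof
  assume "v \<in> normal_cone F a"
  then obtain t x z where *: "\<And>i. t i \<ge> 0" "x \<longlonglongrightarrow> a" "\<And>i. z i \<in> proj_set F (x i)"
      "(\<lambda>i. t i *\<^sub>R (x i - z i)) \<longlonglongrightarrow> v"
    unfolding normal_cone_def by blast
  show ?R
  proof (intro allI impI)
    fix e :: real assume "e > 0"
    then have "\<forall>\<^sub>F i in sequentially. dist (x i) a < e \<and> dist (t i *\<^sub>R (x i - z i)) v < e"
      using tendstoD[OF *(2)] tendstoD[OF *(4)] by (simp add: eventually_conj)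
    then obtain i where "dist (x i) a < e" "dist (t i *\<^sub>R (x i - z i)) v < e"
      using eventually_happens'[OF sequentially_bot] by blast
    then show "\<exists>t x z. 0 \<le> t \<and> dist x a < e \<and> z \<in> proj_set F x \<and> dist (t *\<^sub>R (x - z)) v < e"
      using *(1,3) by blast
  qed
next
  assume R: ?R
  have "\<forall>i::nat. \<exists>t x z. 0 \<le> t \<and> dist x a < inverse (real (Suc i)) \<and> z \<in> proj_set F x
      \<and> dist (t *\<^sub>R (x - z)) v < inverse (real (Suc i))"
    using R by simp
  then obtain t x z where *: "\<And>i::nat. 0 \<le> t i \<and> dist (x i) a < inverse (real (Suc i)) \<and>
      z i \<in> proj_set F (x i) \<and> dist (t i *\<^sub>R (x i - z i)) v < inverse (real (Suc i))"
    by metis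
  have "x \<longlonglongrightarrow> a" "(\<lambda>i. t i *\<^sub>R (x i - z i)) \<longlonglongrightarrow> v"
    by (rule metric_tendsto_imp_tendsto[OF LIMSEQ_inverse_real_of_nat];
        use * in \<open>auto intro!: always_eventually less_imp_le simp: dist_norm\<close>)+
  then show "v \<in> normal_cone F a"
    unfolding normal_cone_def using * by blast
qed

lemma closed_normal_cone: "closed (normal_cone F a)"
proof -
  have "closure (normal_cone F a) = normal_cone F a"
  proof (intro equalityI closure_subset subsetI)
    fix v assume v: "v \<in> closure (normal_cone F a)"
    show "v \<in> normal_cone F a"
      unfolding mem_normal_cone_iff
    proof (intro allI impI)
      fix e :: real assume "e > 0"
      then obtain w where w: "w \<in> normal_cone F a" "dist w v < e / 2"
        using v closure_approachable half_gt_zero by metis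
      obtain t x z where "0 \<le> t" "dist x a < e / 2" "z \<in> proj_set F x"
          "dist (t *\<^sub>R (x - z)) w < e / 2"
        using w(1) \<open>e > 0\<close> unfolding mem_normal_cone_iff by (meson half_gt_zero)
      moreover have "dist (t *\<^sub>R (x - z)) v < e"
        using dist_triangle_half_l[OF calculation(4), of v] w(2) by (simp add: dist_commute)
      ultimately show "\<exists>t x z. 0 \<le> t \<and> dist x a < e \<and> z \<in> proj_set F x
          \<and> dist (t *\<^sub>R (x - z)) v < e"
        using \<open>e > 0\<close> by (metis field_sum_of_halves less_add_same_cancel1 half_gt_zero order.strict_trans)
    qed
  qed
  then show ?thesis by (simp add: closure_eq)
qed

lemma normal_cone_scaleR:
  assumes "v \<in> normal_cone F a" and "0 \<le> s"
  shows "s *\<^sub>R v \<in> normal_cone F a"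
proof -
  obtain t x z where *: "\<And>i. t i \<ge> 0" "x \<longlonglongrightarrow> a" "\<And>i. z i \<in> proj_set F (x i)"
      "(\<lambda>i. t i *\<^sub>R (x i - z i)) \<longlonglongrightarrow> v"
    using assms(1) unfolding normal_cone_def by blast
  have "(\<lambda>i. (s * t i) *\<^sub>R (x i - z i)) \<longlonglongrightarrow> s *\<^sub>R v"
    using tendsto_scaleR[OF tendsto_const *(4), of s] by simp
  then show ?thesis
    unfolding normal_cone_def using * \<open>0 \<le> s\<close> by (auto intro!: exI[of _ "\<lambda>i. s * t i"])
qed

text \<open>The point of \<open>F\<close> is its own projection, so the constant choice x = z = a
  gives the zero normal.\<close>

lemma zero_in_normal_cone:
  assumes "a \<in> F"
  shows "0 \<in> normal_cone F a"
  unfolding mem_normal_cone_iff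
proof (intro allI impI exI conjI)
  show "a \<in> proj_set F a" using assms by (simp add: mem_proj_set_iff)
qed auto

section \<open>The regularity constant\<close>

text \<open>Continuous image of a product of two compact sets. With nonemptiness it turns the
  supremum in \<open>regularity_const\<close> into a genuine maximum.\<close>

lemma compact_normal_products: "compact (normal_products F C a)"
proof -
  let ?U = "normal_cone F a \<inter> cball 0 1" and ?V = "uminus ` normal_cone C a \<inter> cball 0 1"
  have "normal_products F C a = (\<lambda>p. fst p \<bullet> snd p) ` (?U \<times> ?V)"
    unfolding normal_products_def by (force simp: image_iff)
  moreover have "compact (?U \<times> ?V)"
    by (intro compact_Times closed_Int_compact closed_normal_cone closed_negations compact_cball)
  ultimately show ?thesis
    by (auto intro!: compact_continuous_image continuous_intros)
qed

lemma zero_in_normal_products: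
  assumes "a \<in> F \<inter> C"
  shows "0 \<in> normal_products F C a"
proof -
  have "0 \<in> normal_cone F a" "0 \<in> uminus ` normal_cone C a"
    using assms zero_in_normal_cone[of a F] zero_in_normal_cone[of a C] by (auto simp: image_iff)
  then show ?thesis
    unfolding normal_products_def by (auto intro!: exI[of _ 0])
qed

lemma regularity_const_attained:
  assumes "a \<in> F \<inter> C"
  shows "regularity_const F C a \<in> normal_products F C a"
  unfolding regularity_const_def
proof (rule closed_contains_Sup)
  show "normal_products F C a \<noteq> {}" using zero_in_normal_products[OF assms] by blast
qed (intro bounded_imp_bdd_above compact_imp_bounded compact_imp_closed compact_normal_products)+

lemma normal_products_le_regularity_const:
  assumes "p \<in> normal_products F C a"
  shows "p \<le> regularity_const F C a"
  unfolding regularity_const_def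
  by (intro cSup_upper assms bounded_imp_bdd_above compact_imp_bounded compact_normal_products)

text \<open>Equality case of Cauchy-Schwarz. If the maximum, attained at u and v in the unit ball,
  were at least 1, then |u - v|^2 = |u|^2 + |v|^2 - 2 <u,v> \<le> 0, so u = v would be a nonzero
  common vector. Conversely, a nonzero common vector, rescaled to norm one and paired with itself,
  yields the product 1.\<close>

lemma strongly_regular_intersection_iff:
  assumes a: "a \<in> F \<inter> C"
  shows "strongly_regular_intersection F C a \<longleftrightarrow> regularity_const F C a < 1"
proof
  assume S: "strongly_regular_intersection F C a"
  obtain u v where uv: "regularity_const F C a = u \<bullet> v"
      "u \<in> normal_cone F a" "norm u \<le> 1" "v \<in> uminus ` normal_cone C a" "norm v \<le> 1"
    using regularity_const_attained[OF a] unfolding normal_products_def by auto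
  show "regularity_const F C a < 1"
  proof (rule ccontr)
    assume "\<not> ?thesis"
    then have ge: "u \<bullet> v \<ge> 1" using uv by simp
    have "u \<bullet> u \<le> 1" "v \<bullet> v \<le> 1"
      using uv by (simp_all add: norm_le_square)
    then have "(u - v) \<bullet> (u - v) \<le> 0"
      using ge by (simp add: inner_diff_left inner_diff_right inner_commute)
    then have "u = v" by (metis inner_gt_zero_iff not_less eq_iff_diff_eq_0)
    then have "u = 0" using S uv unfolding strongly_regular_intersection_def by blast
    then show False using ge by simp
  qed
next
  assume L: "regularity_const F C a < 1"
  have "w = 0" if w: "w \<in> normal_cone F a" "w \<in> uminus ` normal_cone C a" for w
  proof (rule ccontr)
    assume "w \<noteq> 0"
    define s where "s = w /\<^sub>R norm w"
    have "s \<in> normal_cone F a" using w(1) by (simp add: s_def normal_cone_scaleR)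
    moreover obtain w' where "w' \<in> normal_cone C a" "w = - w'" using w by blast
    then have "s \<in> uminus ` normal_cone C a"
      using normal_cone_scaleR[of w' C a "inverse (norm w)"] unfolding s_def
      by (auto simp: image_iff intro!: bexI[of _ "w' /\<^sub>R norm w"])
    moreover have "norm s = 1" using \<open>w \<noteq> 0\<close> by (simp add: s_def)
    moreover from this have "s \<bullet> s = 1" by (simp add: norm_eq_1)
    ultimately have "1 \<in> normal_products F C a"
      unfolding normal_products_def by (auto intro!: exI[of _ s])
    then show False using normal_products_le_regularity_const L by force
  qed
  moreover have "0 \<in> normal_cone F a" "0 \<in> uminus ` normal_cone C a"
    using a zero_in_normal_cone[of a F] zero_in_normal_cone[of a C] by (auto simp: image_iff)
  ultimately show "strongly_regular_intersection F C a"
    unfolding strongly_regular_intersection_def by blast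
qed

section \<open>Angle estimate and contraction of one step\<close>

lemma normalized_limit_in_normal_cone:
  assumes "x \<longlonglongrightarrow> a" and "\<And>i. z i \<in> proj_set F (x i)" and "(\<lambda>i. sgn (x i - z i)) \<longlonglongrightarrow> v"
  shows "v \<in> normal_cone F a"
  unfolding normal_cone_def mem_Collect_eq
proof (intro exI conjI allI)
  show "(\<lambda>i. inverse (norm (x i - z i)) *\<^sub>R (x i - z i)) \<longlonglongrightarrow> v"
    using assms(3) by (simp add: sgn_div_norm)
qed (use assms in auto)

text \<open>By contradiction: violations ever closer to \<open>a\<close> give unit directions that
  subconverge to normals of \<open>F\<close> and \<open>C\<close> at \<open>a\<close>, whose product
  would be at least \<open>c\<close> and yet at most the regularity constant.\<close>

lemma angle_bound:
  assumes c: "regularity_const F C a < c"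
  obtains e where "e > 0"
    and "\<And>z y u. \<lbrakk>dist z a < e; dist y a < e; y \<in> proj_set F z; u \<in> proj_set C y\<rbrakk>
      \<Longrightarrow> (z - y) \<bullet> (u - y) \<le> c * norm (z - y) * norm (u - y)"
proof -
  have "\<exists>e>0. \<forall>z y u. dist z a < e \<and> dist y a < e \<and> y \<in> proj_set F z \<and> u \<in> proj_set C y
      \<longrightarrow> (z - y) \<bullet> (u - y) \<le> c * norm (z - y) * norm (u - y)"
  proof (rule ccontr)
    assume "\<not> ?thesis"
    then have "\<forall>i::nat. \<exists>z y u. dist z a < inverse (real (Suc i)) \<and> dist y a < inverse (real (Suc i))
        \<and> y \<in> proj_set F z \<and> u \<in> proj_set C y
        \<and> c * norm (z - y) * norm (u - y) < (z - y) \<bullet> (u - y)"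
      by (meson inverse_positive_iff_positive of_nat_0_less_iff zero_less_Suc not_le)
    then obtain z y u where *: "\<And>i::nat. dist (z i) a < inverse (real (Suc i))
        \<and> dist (y i) a < inverse (real (Suc i)) \<and> y i \<in> proj_set F (z i) \<and> u i \<in> proj_set C (y i)
        \<and> c * norm (z i - y i) * norm (u i - y i) < (z i - y i) \<bullet> (u i - y i)"
      by metis
    have lim: "z \<longlonglongrightarrow> a" "y \<longlonglongrightarrow> a"
      by (rule metric_tendsto_imp_tendsto[OF LIMSEQ_inverse_real_of_nat];
          use * in \<open>auto intro!: always_eventually less_imp_le simp: dist_norm\<close>)+
    \<comment> \<open>Pairing the directions lets one subsequence serve both. The second is
      \<open>y i - u i\<close>, the proximal normal to \<open>C\<close>; its negative belongs to the
      side -N_C of the products.\<close>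
    define p where "p i = (sgn (z i - y i), sgn (y i - u i))" for i
    have "p i \<in> cball 0 1 \<times> cball 0 1" for i
      by (auto simp: p_def norm_sgn)
    moreover have "compact (cball (0::'a) 1 \<times> cball (0::'a) 1)"
      by (intro compact_Times compact_cball)
    ultimately obtain l r where l: "l \<in> cball 0 1 \<times> cball 0 1" and r: "strict_mono r"
        and pl: "(p \<circ> r) \<longlonglongrightarrow> l"
      unfolding compact_def by metis
    obtain v w where vw: "l = (v, w)" by force
    have v: "(\<lambda>i. sgn (z (r i) - y (r i))) \<longlonglongrightarrow> v" and w: "(\<lambda>i. sgn (y (r i) - u (r i))) \<longlonglongrightarrow> w"
      using tendsto_fst[OF pl] tendsto_snd[OF pl] by (simp_all add: vw p_def o_def)
    have "v \<in> normal_cone F a"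
      by (rule normalized_limit_in_normal_cone[OF LIMSEQ_subseq_LIMSEQ[OF lim(1) r]])
         (use * v in \<open>auto simp: o_def\<close>)
    moreover have "w \<in> normal_cone C a"
      by (rule normalized_limit_in_normal_cone[OF LIMSEQ_subseq_LIMSEQ[OF lim(2) r]])
         (use * w in \<open>auto simp: o_def\<close>)
    ultimately have "v \<bullet> (- w) \<in> normal_products F C a"
      using l unfolding normal_products_def vw by force
    then have "v \<bullet> (- w) < c" using normal_products_le_regularity_const c by force
    moreover have "c \<le> v \<bullet> (- w)"
    proof (rule LIMSEQ_le_const)
      show "(\<lambda>i. sgn (z (r i) - y (r i)) \<bullet> (- sgn (y (r i) - u (r i)))) \<longlonglongrightarrow> v \<bullet> (- w)"
        by (intro tendsto_intros v w)
      have "c \<le> sgn (z i - y i) \<bullet> (- sgn (y i - u i))" for i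
      proof -
        have lt: "c * norm (z i - y i) * norm (u i - y i) < (z i - y i) \<bullet> (u i - y i)" using * by blast
        \<comment> \<open>The violated inequality is strict, which rules out zero differences and
          permits division by the norms.\<close>
        then have "z i \<noteq> y i" "u i \<noteq> y i" by auto
        then have "norm (z i - y i) * norm (u i - y i) > 0" by simp
        then have "c \<le> (z i - y i) \<bullet> (u i - y i) / (norm (z i - y i) * norm (u i - y i))"
          using lt by (simp add: pos_le_divide_eq mult.assoc less_imp_le)
        also have "\<dots> = sgn (z i - y i) \<bullet> sgn (u i - y i)"
          by (simp add: sgn_div_norm divide_simps)
        also have "sgn (u i - y i) = - sgn (y i - u i)"
          by (metis minus_diff_eq sgn_minus)
        finally show ?thesis .
      qed
      then show "\<exists>N. \<forall>n\<ge>N. c \<le> sgn (z (r n) - y (r n)) \<bullet> (- sgn (y (r n) - u (r n)))"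
        by blast
    qed
    ultimately show False by simp
  qed
  then show thesis using that by metis
qed

lemma projection_step_contracts:
  assumes C: "super_regular_at C a" and c: "regularity_const F C a < c" "0 \<le> c"
  obtains e where "e > 0"
    and "\<And>z y u. \<lbrakk>dist z a < e; dist y a < e; z \<in> C; y \<in> proj_set F z; u \<in> proj_set C y\<rbrakk>
      \<Longrightarrow> dist y u \<le> c * dist z y"
proof -
  \<comment> \<open>The gap between the regularity constant and \<open>c\<close> is split: half goes
    to the angle bound \<open>b\<close>, the rest is \<open>2 * d\<close>, with \<open>d\<close> the
    super-regularity tolerance.\<close>
  define b where "b = (regularity_const F C a + c) / 2"
  define d where "d = (c - b) / 2"
  have b: "regularity_const F C a < b" and d: "d > 0" and bd: "b + 2 * d = c"
    using c by (auto simp: b_def d_def field_simps)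
  obtain e1 where e1: "e1 > 0" and
    A: "\<And>z y u. \<lbrakk>dist z a < e1; dist y a < e1; y \<in> proj_set F z; u \<in> proj_set C y\<rbrakk>
      \<Longrightarrow> (z - y) \<bullet> (u - y) \<le> b * norm (z - y) * norm (u - y)"
    using angle_bound[OF b] by blast
  obtain U where "open U" "a \<in> U" and
    S: "\<And>u z y. \<lbrakk>u \<in> U; z \<in> U \<inter> C; y \<in> proj_set C u\<rbrakk>
      \<Longrightarrow> (z - y) \<bullet> (u - y) \<le> d * norm (z - y) * norm (u - y)"
    using C d unfolding super_regular_at_def by metis
  then obtain e2 where e2: "e2 > 0" "\<And>x. dist x a < e2 \<Longrightarrow> x \<in> U"
    by (metis open_dist)
  show thesis
  proof (rule that)
    show "min e1 e2 > 0" using e1 e2 by simp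
    fix z y u
    assume H: "dist z a < min e1 e2" "dist y a < min e1 e2" "z \<in> C" "y \<in> proj_set F z"
      "u \<in> proj_set C y"
    \<comment> \<open>\<open>z\<close> lies in \<open>C\<close>, so it competes with the nearest
      point \<open>u\<close> of \<open>y\<close>.\<close>
    have near: "norm (u - y) \<le> norm (z - y)"
      using H(3,5) by (simp add: mem_proj_set_iff dist_norm norm_minus_commute[of y])
    then have "norm (z - u) \<le> 2 * norm (z - y)"
      using norm_triangle_ineq4[of "z - y" "u - y"] by simp
    then have "d * norm (z - u) * norm (y - u) \<le> d * (2 * norm (z - y)) * norm (y - u)"
      using d by (intro mult_right_mono mult_left_mono) auto
    moreover have "(z - y) \<bullet> (u - y) \<le> b * norm (z - y) * norm (u - y)"
      using A H by simp
    \<comment> \<open>Super-regularity, with \<open>y\<close> as the projected point and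
      \<open>u\<close> as its projection.\<close>
    moreover have "(z - u) \<bullet> (y - u) \<le> d * norm (z - u) * norm (y - u)"
      using S H e2 by simp
    moreover have "norm (u - y) * norm (u - y) = (z - y) \<bullet> (u - y) + (z - u) \<bullet> (y - u)"
      by (simp flip: power2_eq_square add: power2_norm_eq_inner inner_diff_left inner_diff_right
          inner_commute)
    ultimately have "norm (u - y) * norm (u - y) \<le> (c * norm (z - y)) * norm (u - y)"
      by (simp flip: bd add: algebra_simps norm_minus_commute[of y u])
    then show "dist y u \<le> c * dist z y"
      using \<open>0 \<le> c\<close> by (cases "u = y") (auto simp: dist_norm norm_minus_commute)
  qed
qed

section \<open>Convergence of the iterates\<close>

lemma geometric_steps_converge:
  fixes x :: "nat \<Rightarrow> 'a::complete_space"
  assumes step: "\<And>k. dist (x k) (x (Suc k)) \<le> d * r ^ k" and r: "0 \<le> r" "r < 1"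
  obtains l where "x \<longlonglongrightarrow> l" and "\<And>k. dist (x k) l \<le> d / (1 - r) * r ^ k"
proof -
  have d: "0 \<le> d" using order_trans[OF zero_le_dist step[of 0]] by simp
  have bound: "dist (x k) (x (k + m)) \<le> d / (1 - r) * r ^ k" for k m
  proof -
    \<comment> \<open>The exact partial geometric sum, kept so that the induction closes; the
      subtracted power is dropped only afterwards.\<close>
    have "dist (x k) (x (k + m)) \<le> d / (1 - r) * (r ^ k - r ^ (k + m))"
    proof (induction m)
      case (Suc m)
      have "dist (x k) (x (k + Suc m)) \<le> dist (x k) (x (k + m)) + dist (x (k + m)) (x (Suc (k + m)))"
        by (metis add_Suc_right dist_triangle)
      also have "\<dots> \<le> d / (1 - r) * (r ^ k - r ^ (k + m)) + d * r ^ (k + m)"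
        using Suc step by (intro add_mono)
      also have "\<dots> = d / (1 - r) * (r ^ k - r ^ (k + Suc m))"
        using r by (simp add: field_simps)
      finally show ?case .
    qed simp
    also have "\<dots> \<le> d / (1 - r) * r ^ k"
      using d r by (intro mult_left_mono) auto
    finally show ?thesis .
  qed
  have lim0: "(\<lambda>k. d / (1 - r) * r ^ k) \<longlonglongrightarrow> 0"
    using r by (intro tendsto_mult_right_zero LIMSEQ_power_zero) auto
  have "Cauchy x"
  proof (rule CauchyI')
    fix e :: real assume "e > 0"
    then obtain N where N: "\<And>k. k \<ge> N \<Longrightarrow> d / (1 - r) * r ^ k < e"
      using order_tendstoD(2)[OF lim0] by (auto simp: eventually_sequentially)
    have "dist (x m) (x n) < e" if "m \<ge> N" "n > m" for m n
      using bound[of m "n - m"] N[of m] that by simp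
    then show "\<exists>M. \<forall>m\<ge>M. \<forall>n>m. dist (x m) (x n) < e" by blast
  qed
  then obtain l where l: "x \<longlonglongrightarrow> l" using Cauchy_convergent convergent_def by blast
  have "dist (x k) l \<le> d / (1 - r) * r ^ k" for k
  proof (rule LIMSEQ_le_const2)
    show "(\<lambda>m. dist (x k) (x (m + k))) \<longlonglongrightarrow> dist (x k) l"
      by (intro tendsto_intros LIMSEQ_ignore_initial_segment l)
    show "\<exists>N. \<forall>m\<ge>N. dist (x k) (x (m + k)) \<le> d / (1 - r) * r ^ k"
      using bound[of k] by (simp add: add.commute)
  qed
  with l show thesis using that by blast
qed

text \<open>The contraction holds only near \<open>a\<close>, so step lengths and location are
  controlled in one induction. The factor 1 + 2 (1 - c^n) / (1 - c) is 1 plus twice the sum of c^j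
  over j < n: each round trip moves the iterate by at most \<open>2 * (d * c ^ n)\<close>.\<close>

lemma iterated_projections_steps:
  assumes a: "a \<in> F" and c: "0 < c" "c < 1"
    and contr: "\<And>z y u. \<lbrakk>dist z a < e; dist y a < e; z \<in> C; y \<in> proj_set F z; u \<in> proj_set C y\<rbrakk>
      \<Longrightarrow> dist y u \<le> c * dist z y"
    and x: "iterated_projections F C x" "x 0 \<in> C"
    and near: "dist (x 0) a * (1 + 3 / (1 - c)) < e"
  shows "dist (x (2 * n)) (x (2 * n + 1)) \<le> dist (x 0) a * c ^ n"
    and "dist (x (2 * n + 1)) (x (2 * n + 2)) \<le> dist (x 0) a * c ^ Suc n"
proof -
  define d where "d = dist (x 0) a"
  have d: "0 \<le> d" by (simp add: d_def)
  have P: "x (2 * n + 1) \<in> proj_set F (x (2 * n))" "x (2 * n + 2) \<in> proj_set C (x (2 * n + 1))" for n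
    using x(1) unfolding iterated_projections_def by auto
  have even_C: "x (2 * n) \<in> C" for n
  proof (cases n)
    case (Suc m)
    then show ?thesis using P(2)[of m] by (simp add: mem_proj_set_iff)
  qed (use x in simp)
  have second: "dist (x (2 * n + 1)) (x (2 * n + 2)) \<le> d * c ^ Suc n"
    if step: "dist (x (2 * n)) (x (2 * n + 1)) \<le> d * c ^ n"
      and loc: "dist (x (2 * n)) a \<le> d * (1 + 2 * (1 - c ^ n) / (1 - c))" for n
  proof -
    have cn: "0 \<le> c ^ n" "c ^ n \<le> 1" using c by (auto simp: power_le_one)
    have "dist (x (2 * n)) a + d * c ^ n \<le> d * (1 + 2 * (1 - c ^ n) / (1 - c)) + d * c ^ n"
      using loc by simp
    also have "\<dots> = d * ((1 + 2 * (1 - c ^ n) / (1 - c)) + c ^ n)" by (simp add: algebra_simps)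
    \<comment> \<open>Origin of the 3: 2 / (1 - c) bounds the accumulated round trips, and 1 / (1 -
      c) bounds \<open>c ^ n\<close>, the allowance for the further step to the odd iterate.\<close>
    also have "\<dots> \<le> d * (1 + 3 / (1 - c))"
    proof (intro mult_left_mono d)
      have "2 * (1 - c ^ n) / (1 - c) \<le> 2 / (1 - c)"
        using cn c by (intro divide_right_mono) auto
      moreover have "c ^ n \<le> 1 / (1 - c)"
        using cn c order_trans[of "c ^ n" 1 "1 / (1 - c)"] by simp
      moreover have "3 / (1 - c) = 2 / (1 - c) + 1 / (1 - c)"
        by (simp flip: add_divide_distrib)
      ultimately show "(1 + 2 * (1 - c ^ n) / (1 - c)) + c ^ n \<le> 1 + 3 / (1 - c)"
        by linarith
    qed
    finally have "dist (x (2 * n)) a + d * c ^ n < e" using near by (simp add: d_def)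
    moreover have "dist (x (2 * n + 1)) a \<le> dist (x (2 * n)) (x (2 * n + 1)) + dist (x (2 * n)) a"
      by (rule dist_triangle3)
    ultimately have "dist (x (2 * n)) a < e" "dist (x (2 * n + 1)) a < e"
      using step d cn by (smt (verit) mult_nonneg_nonneg)+
    then have "dist (x (2 * n + 1)) (x (2 * n + 2)) \<le> c * dist (x (2 * n)) (x (2 * n + 1))"
      using contr even_C P by blast
    also have "\<dots> \<le> c * (d * c ^ n)" using step c by simp
    finally show ?thesis by (simp add: algebra_simps)
  qed
  have main: "dist (x (2 * n)) (x (2 * n + 1)) \<le> d * c ^ n
      \<and> dist (x (2 * n)) a \<le> d * (1 + 2 * (1 - c ^ n) / (1 - c))" for n
  proof (induction n)
    case 0
    \<comment> \<open>\<open>a\<close> lies in \<open>F\<close> and competes with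
      \<open>x 1\<close>, so the first step is at most \<open>d\<close>.\<close>
    show ?case using P(1)[of 0] a by (simp add: mem_proj_set_iff d_def)
  next
    case (Suc n)
    let ?p = "x (2 * n)" and ?q = "x (2 * n + 1)" and ?s = "x (2 * n + 2)"
    have pq: "dist ?p ?q \<le> d * c ^ n" and qs: "dist ?q ?s \<le> d * c ^ Suc n"
      using Suc second by auto
    \<comment> \<open>The previous point \<open>?q\<close> of \<open>F\<close> competes in the
      projection of \<open>?s\<close> onto \<open>F\<close>.\<close>
    have "dist ?s (x (2 * Suc n + 1)) \<le> dist ?s ?q"
      using P(1)[of "Suc n"] P(1)[of n] by (simp add: mem_proj_set_iff)
    then have next_step: "dist (x (2 * Suc n)) (x (2 * Suc n + 1)) \<le> d * c ^ Suc n"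
      using qs by (simp add: dist_commute)
    have "d * c ^ Suc n \<le> d * c ^ n"
      using d c by (intro mult_left_mono power_decreasing) auto
    then have "dist ?s a \<le> dist ?p a + 2 * (d * c ^ n)"
      using pq qs dist_triangle[of ?s a ?q] dist_triangle[of ?q a ?p]
      by (simp add: dist_commute)
    then have "dist ?s a \<le> d * (1 + 2 * (1 - c ^ n) / (1 - c)) + 2 * (d * c ^ n)"
      using Suc by simp
    also have "\<dots> = d * (1 + 2 * (1 - c ^ Suc n) / (1 - c))"
      using c by (simp add: field_simps)
    finally have "dist (x (2 * Suc n)) a \<le> d * (1 + 2 * (1 - c ^ Suc n) / (1 - c))" by simp
    with next_step show ?case by blast
  qed
  show "dist (x (2 * n)) (x (2 * n + 1)) \<le> dist (x 0) a * c ^ n"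
    and "dist (x (2 * n + 1)) (x (2 * n + 2)) \<le> dist (x 0) a * c ^ Suc n"
    using main second unfolding d_def by blast+
qed

text \<open>A factor \<open>c\<close> is gained once every two steps, hence the rate
  \<open>sqrt c\<close> per step. The limit is shared by the odd iterates, in \<open>F\<close>, and
  the even ones, in \<open>C\<close>, so closedness places it in both.\<close>

lemma iterated_projections_converge:
  assumes FC: "closed F" "closed C" "a \<in> F" and c: "0 < c" "c < 1"
    and contr: "\<And>z y u. \<lbrakk>dist z a < e; dist y a < e; z \<in> C; y \<in> proj_set F z; u \<in> proj_set C y\<rbrakk>
      \<Longrightarrow> dist y u \<le> c * dist z y"
    and x: "iterated_projections F C x" "x 0 \<in> C"
    and near: "dist (x 0) a * (1 + 3 / (1 - c)) < e"
  shows "\<exists>l\<in>F \<inter> C. R_linear_convergence x l (sqrt c)"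
proof -
  let ?d = "dist (x 0) a"
  have r: "0 < sqrt c" "sqrt c < 1" using c by (auto simp: real_less_rsqrt)
  have even_power: "sqrt c ^ (2 * n) = c ^ n" for n
    using c by (simp add: power_mult)
  have "dist (x k) (x (Suc k)) \<le> ?d * sqrt c ^ k" for k
  proof (cases "even k")
    case True
    then obtain n where "k = 2 * n" by blast
    then show ?thesis
      using iterated_projections_steps(1)[OF FC(3) c contr x near, of n] even_power by simp
  next
    case False
    then obtain n where k: "k = 2 * n + 1" using oddE by blast
    \<comment> \<open>Steps starting in \<open>F\<close> satisfy the bound with exponent
      \<open>Suc k\<close>; the surplus factor \<open>sqrt c\<close> is given away to get a uniform
      estimate.\<close>
    have "?d * c ^ Suc n = ?d * sqrt c ^ Suc k"
      using even_power[of "Suc n"] by (simp add: k)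
    also have "\<dots> \<le> ?d * sqrt c ^ k"
      using r by (intro mult_left_mono power_decreasing) auto
    finally show ?thesis
      using iterated_projections_steps(2)[OF FC(3) c contr x near, of n] k by simp
  qed
  then obtain l where l: "x \<longlonglongrightarrow> l" and K: "\<And>k. dist (x k) l \<le> ?d / (1 - sqrt c) * sqrt c ^ k"
    using geometric_steps_converge r by (metis less_imp_le)
  have "x (2 * n + 1) \<in> F" "x (2 * n + 2) \<in> C" for n
    using x(1) unfolding iterated_projections_def mem_proj_set_iff by auto
  moreover have "(\<lambda>n. x (2 * n + 1)) \<longlonglongrightarrow> l" "(\<lambda>n. x (2 * n + 2)) \<longlonglongrightarrow> l"
    using LIMSEQ_subseq_LIMSEQ[OF l, of "\<lambda>n. 2 * n + 1"]
      LIMSEQ_subseq_LIMSEQ[OF l, of "\<lambda>n. 2 * n + 2"]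
    by (auto simp: strict_mono_def o_def)
  ultimately have "l \<in> F" "l \<in> C"
    using FC closed_sequentially by metis+
  moreover have "R_linear_convergence x l (sqrt c)"
    using r K unfolding R_linear_convergence_def dist_norm by blast
  ultimately show ?thesis by blast
qed

theorem theorem5p15:
  fixes F C :: "'a::euclidean_space set" and xbar :: 'a
  assumes "closed F" and "closed C"
    and "xbar \<in> F \<inter> C"
    and "super_regular_at C xbar"
  shows "regularity_const F C xbar \<in> normal_products F C xbar
    \<and> (strongly_regular_intersection F C xbar \<longleftrightarrow> regularity_const F C xbar < 1)
    \<and> (strongly_regular_intersection F C xbar \<longrightarrow>
        (\<forall>c. regularity_const F C xbar < c \<and> c < 1 \<longrightarrow>
          (\<exists>\<epsilon>>0. \<forall>x :: nat \<Rightarrow> 'a.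
             x 0 \<in> C \<and> dist (x 0) xbar < \<epsilon> \<and> iterated_projections F C x \<longrightarrow>
             (\<exists>xhat \<in> F \<inter> C. R_linear_convergence x xhat (sqrt c)))))"
proof (intro conjI impI allI)
  show "regularity_const F C xbar \<in> normal_products F C xbar"
    using assms(3) by (rule regularity_const_attained)
  show "strongly_regular_intersection F C xbar \<longleftrightarrow> regularity_const F C xbar < 1"
    using assms(3) by (rule strongly_regular_intersection_iff)
next
  fix c assume "regularity_const F C xbar < c \<and> c < 1"
  then have c: "regularity_const F C xbar < c" "c < 1" by auto
  \<comment> \<open>Zero is a product of normals, so the regularity constant is nonnegative.\<close>
  have c0: "0 < c"
    using normal_products_le_regularity_const[OF zero_in_normal_products[OF assms(3)]] c(1) by simp
  obtain e where e: "e > 0" and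
    contr: "\<And>z y u. \<lbrakk>dist z xbar < e; dist y xbar < e; z \<in> C; y \<in> proj_set F z; u \<in> proj_set C y\<rbrakk>
      \<Longrightarrow> dist y u \<le> c * dist z y"
    using projection_step_contracts[OF assms(4) c(1) less_imp_le[OF c0]] by blast
  \<comment> \<open>Starting within \<open>e / M\<close> of \<open>xbar\<close> keeps all iterates
    within the radius \<open>e\<close> where the contraction is valid.\<close>
  define M where "M = 1 + 3 / (1 - c)"
  have M: "M > 0" using c by (simp add: M_def add_pos_pos)
  have "\<exists>xhat\<in>F \<inter> C. R_linear_convergence x xhat (sqrt c)"
    if "x 0 \<in> C \<and> dist (x 0) xbar < e / M \<and> iterated_projections F C x" for x
    using that assms(1-3) c0 c(2) contr M
    by (intro iterated_projections_converge[of F C xbar c e]) (auto simp: M_def pos_less_divide_eq)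
  then show "\<exists>\<epsilon>>0. \<forall>x. x 0 \<in> C \<and> dist (x 0) xbar < \<epsilon> \<and> iterated_projections F C x \<longrightarrow>
      (\<exists>xhat\<in>F \<inter> C. R_linear_convergence x xhat (sqrt c))"
    using e M by (intro exI[of _ "e / M"]) auto
qed

end
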